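(* Let $T:[1,\infty)\to(0,\infty)$ be a non-decreasing function of order $\rho\in(0,\infty)$ and of type $\tau\in(0,\infty)$, and let $\varepsilon_0>0$. Then the set $$N_1=\{r\ge1:(\tau-\varepsilon_0)r^{\rho}\le T(r)\le(\tau+\varepsilon_0)r^{\rho}\}$$ satisfies $$\overline{\operatorname{dens}}(N_1)\ge1-\left(\frac{\tau-\varepsilon_0}{\tau}\right)^{1/\rho}.$$
   Context: The order of a non-decreasing function $T:[1,\infty)\to(0,\infty)$ is $\rho=\limsup_{r\to\infty}\frac{\log T(r)}{\log r}$. If $\rho\in(0,\infty)$, the type of $T$ with respect to its order is $\tau=\limsup_{r\to\infty}\frac{T(r)}{r^{\rho}}$. The upper (linear) density of a set $D\subset[1,\infty)$ is $$\overline{\operatorname{dens}}(D)=\limsup_{r\to\infty}\frac1r\int_{D\cap[1,r]}dt.$$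
   Formalization: For ε₀ > τ the base (τ−ε₀)/τ is negative, so the stated bound is undefined or can exceed 1 (T(r)=r, ε₀=2); the formal theorem reads the power there as that of the absolute value of the base. For 0 < ε₀ ≤ τ it is the stated claim. *)

theory Defs
  imports "HOL-Analysis.Analysis"
begin

text \<open>
  A function on $[1,\infty)$ is represented by a total function \<^typ>\<open>real \<Rightarrow> real\<close> of which only the
  values on \<open>{1..}\<close> matter; all upper limits are at infinity and take values in \<^typ>\<open>ereal\<close>.
\<close>

definition growth_order :: "(real \<Rightarrow> real) \<Rightarrow> ereal" where
  "growth_order T = Limsup at_top (\<lambda>r. ereal (ln (T r) / ln r))"

text \<open>Only meaningful when \<^term>\<open>growth_order T\<close> is finite and positive.\<close>

definition growth_type :: "(real \<Rightarrow> real) \<Rightarrow> ereal" where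
  "growth_type T =
     Limsup at_top (\<lambda>r. ereal (T r / r powr real_of_ereal (growth_order T)))"

text \<open>Only meaningful for Lebesgue measurable \<open>D\<close>, since the integral defaults to 0 otherwise.\<close>

definition upper_linear_density :: "real set \<Rightarrow> ereal" where
  "upper_linear_density D =
     Limsup at_top (\<lambda>r::real. ereal (1 / r * (LINT t:D \<inter> {1..r}|lebesgue. (1::real))))"

end

theory Submission
  imports Defs
begin

text \<open>
  If \<open>T R > (\<tau> - \<delta>) R\<^sup>\<rho>\<close> for a large \<open>R\<close>, then monotonicity keeps \<open>T r \<ge> (\<tau> - \<epsilon>\<^sub>0) r\<^sup>\<rho>\<close> until
  \<open>(\<tau> - \<epsilon>\<^sub>0) r\<^sup>\<rho>\<close> has caught up with \<open>(\<tau> - \<delta>) R\<^sup>\<rho>\<close>, so \<open>N\<^sub>1\<close> contains an interval \<open>[R, R / s]\<close>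
  with \<open>s\<close> close to \<open>((\<tau> - \<epsilon>\<^sub>0) / \<tau>)\<^bsup>1/\<rho>\<^esup>\<close>.
\<close>

lemma less_LimsupD_frequently:
  fixes f :: "'a \<Rightarrow> 'b::complete_linorder"
  assumes "C < Limsup F f"
  shows "\<exists>\<^sub>F x in F. C < f x"
proof (rule ccontr)
  assume "\<not> (\<exists>\<^sub>F x in F. C < f x)"
  then have "\<forall>\<^sub>F x in F. f x \<le> C"
    by (simp add: not_frequently not_less)
  then have "Limsup F f \<le> C"
    by (rule Limsup_bounded)
  with assms show False by simp
qed

lemma frequently_le_Limsup:
  fixes f :: "'a \<Rightarrow> 'b::{complete_linorder}"
  assumes "\<exists>\<^sub>F x in F. C \<le> f x"
  shows "C \<le> Limsup F f"
proof (rule ccontr)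
  assume "\<not> C \<le> Limsup F f"
  then have "Limsup F f < C" by simp
  then have "\<forall>\<^sub>F x in F. f x < C"
    by (rule Limsup_lessD)
  with assms show False
    by (simp add: frequently_def not_le)
qed

text \<open>At the radius \<open>r = R / s\<close> the interval \<open>{R..R / s}\<close> alone has
  length \<open>(1 - s) * r\<close>, so the average of the indicator of \<open>D\<close> over
  \<open>{1..r}\<close> is at least \<open>1 - s\<close>. Such radii are arbitrarily large.\<close>

lemma upper_linear_density_ge:
  fixes D :: "real set" and s :: real
  assumes D: "D \<in> sets lebesgue" and s: "0 < s" "s < 1"
    and freq: "\<exists>\<^sub>F R in at_top. {R..R / s} \<subseteq> D"
  shows "ereal (1 - s) \<le> upper_linear_density D"
  unfolding upper_linear_density_def
proof (rule frequently_le_Limsup)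
  show "\<exists>\<^sub>F r in at_top. ereal (1 - s) \<le> ereal (1 / r * (LINT t:D \<inter> {1..r}|lebesgue. (1::real)))"
    unfolding frequently_def
  proof
    assume "\<forall>\<^sub>F r in at_top. \<not> ereal (1 - s) \<le> ereal (1 / r * (LINT t:D \<inter> {1..r}|lebesgue. (1::real)))"
    then obtain r0 where r0: "\<And>r. r \<ge> r0 \<Longrightarrow> \<not> 1 - s \<le> 1 / r * (LINT t:D \<inter> {1..r}|lebesgue. (1::real))"
      by (auto simp: eventually_at_top_linorder)
    have "\<exists>\<^sub>F R in at_top. {R..R / s} \<subseteq> D \<and> R \<ge> max 1 r0"
      using frequently_eventually_frequently[OF freq eventually_ge_at_top[of "max 1 r0"]] .
    then obtain R where R: "{R..R / s} \<subseteq> D" "R \<ge> 1" "R \<ge> r0"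
      by (auto dest: frequently_ex)
    have RR: "R \<le> R / s"
      using R s by (simp add: field_simps)
    \<comment> \<open>Finite measure is what makes the measure monotone here and lets the integral
      of 1 equal the measure.\<close>
    have fin: "D \<inter> {1..R / s} \<in> lmeasurable"
      using D by (metis Int_commute fmeasurable_Int_fmeasurable lmeasurable_interval(1) box_real(2) lmeasurable_cbox)
    have "R / s - R = measure lebesgue {R..R / s}"
      using RR by simp
    also have "\<dots> \<le> measure lebesgue (D \<inter> {1..R / s})"
      using R fin by (intro measure_mono_fmeasurable) auto
    also have "\<dots> = (LINT t:D \<inter> {1..R / s}|lebesgue. (1::real))"
      using fin by (simp add: set_lebesgue_integral_def)
    finally have "s / R * (R / s - R) \<le> s / R * (LINT t:D \<inter> {1..R / s}|lebesgue. (1::real))"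
      using s R by (intro mult_left_mono) auto
    moreover have "s / R * (R / s - R) = 1 - s"
      using s R by (simp add: field_simps)
    ultimately show False
      using r0[of "R / s"] R RR by simp
  qed
qed

text \<open>Nothing is known about \<open>T\<close> below \<open>a\<close>; replacing the argument
  by \<open>max a r\<close> makes the function monotone on the whole line, hence Borel.\<close>

lemma borel_measurable_mono_on_atLeast:
  fixes T :: "real \<Rightarrow> real"
  assumes "mono_on {a..} T"
  shows "(\<lambda>r. T (max a r)) \<in> borel_measurable borel"
  using assms by (intro borel_measurable_mono) (auto simp: mono_on_def mono_def)

theorem corollary4p4:
  fixes T :: "real \<Rightarrow> real" and \<rho> \<tau> \<epsilon>\<^sub>0 :: real
  assumes "mono_on {1..} T"
    and "\<And>r. r \<ge> 1 \<Longrightarrow> T r > 0"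
    and "growth_order T = ereal \<rho>" and "\<rho> > 0"
    and "growth_type T = ereal \<tau>" and "\<tau> > 0"
    and "\<epsilon>\<^sub>0 > 0"
  shows "upper_linear_density
           {r. r \<ge> 1 \<and> (\<tau> - \<epsilon>\<^sub>0) * r powr \<rho> \<le> T r \<and> T r \<le> (\<tau> + \<epsilon>\<^sub>0) * r powr \<rho>}
         \<ge> ereal (1 - ((\<tau> - \<epsilon>\<^sub>0) / \<tau>) powr (1 / \<rho>))"
proof -
  define a where "a = \<tau> - \<epsilon>\<^sub>0"
  define D where "D = {r. r \<ge> 1 \<and> a * r powr \<rho> \<le> T r \<and> T r \<le> (\<tau> + \<epsilon>\<^sub>0) * r powr \<rho>}"
  define q where "q = (a / \<tau>) powr (1 / \<rho>)"
  have type: "Limsup at_top (\<lambda>r. ereal (T r / r powr \<rho>)) = ereal \<tau>"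
    using assms(3,5) by (simp add: growth_type_def)
  have "\<forall>\<^sub>F r in at_top. ereal (T r / r powr \<rho>) < ereal (\<tau> + \<epsilon>\<^sub>0)"
    using \<open>\<epsilon>\<^sub>0 > 0\<close> by (intro Limsup_lessD) (simp add: type)
  then obtain r0 where "\<And>r. r \<ge> r0 \<Longrightarrow> T r / r powr \<rho> < \<tau> + \<epsilon>\<^sub>0"
    by (auto simp: eventually_at_top_linorder)
  then have upper: "T r \<le> (\<tau> + \<epsilon>\<^sub>0) * r powr \<rho>" if "r \<ge> r0" "r \<ge> 1" for r
    using that by (smt (verit) pos_divide_less_eq powr_gt_zero)

  have "D = {r. r \<ge> 1 \<and> a * r powr \<rho> \<le> T (max 1 r) \<and> T (max 1 r) \<le> (\<tau> + \<epsilon>\<^sub>0) * r powr \<rho>}"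
    by (auto simp: D_def)
  also have "\<dots> \<in> sets borel"
    using borel_measurable_mono_on_atLeast[OF assms(1)] by measurable
  finally have D: "D \<in> sets lebesgue" by auto

  \<comment> \<open>The condition on \<open>s\<close> says that the level
    \<open>a / s powr \<rho>\<close> lies strictly below the type, so
    \<open>T R / R powr \<rho>\<close> exceeds it for arbitrarily large \<open>R\<close>.\<close>
  have bound: "ereal (1 - s) \<le> upper_linear_density D"
    if s: "0 < s" "s < 1" and a: "a < \<tau> * s powr \<rho>" for s
  proof (rule upper_linear_density_ge[OF D s])
    have "a / s powr \<rho> < \<tau>"
      using a s by (simp add: field_simps)
    then have "\<exists>\<^sub>F R in at_top. ereal (a / s powr \<rho>) < ereal (T R / R powr \<rho>)"
      by (intro less_LimsupD_frequently) (simp add: type)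
    then have "\<exists>\<^sub>F R in at_top. ereal (a / s powr \<rho>) < ereal (T R / R powr \<rho>) \<and> R \<ge> max 1 r0"
      by (rule frequently_eventually_frequently) (rule eventually_ge_at_top)
    then show "\<exists>\<^sub>F R in at_top. {R..R / s} \<subseteq> D"
    proof (rule frequently_elim1)
      fix R assume "ereal (a / s powr \<rho>) < ereal (T R / R powr \<rho>) \<and> R \<ge> max 1 r0"
      then have R: "a / s powr \<rho> < T R / R powr \<rho>" "R \<ge> 1" "R \<ge> r0" by auto
      then have TR: "a * (R / s) powr \<rho> < T R"
        using s by (simp add: powr_divide field_simps)
      show "{R..R / s} \<subseteq> D"
      proof
        fix r assume r: "r \<in> {R..R / s}"
        have "T R \<le> T r"
          using assms(1) R r by (auto simp: mono_on_def)
        moreover have "a * r powr \<rho> \<le> T r"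
        \<comment> \<open>For \<open>a \<ge> 0\<close> the function \<open>a * r powr \<rho>\<close>
          is largest at the right end \<open>R / s\<close>, where it is still below
          \<open>T R\<close>. For \<open>a < 0\<close> positivity of \<open>T\<close>
          suffices.\<close>
        proof (cases "a \<ge> 0")
          case True
          then have "a * r powr \<rho> \<le> a * (R / s) powr \<rho>"
            using r R \<open>\<rho> > 0\<close> by (intro mult_left_mono powr_mono2) auto
          with TR \<open>T R \<le> T r\<close> show ?thesis by simp
        next
          case False
          then have "a * r powr \<rho> \<le> 0" by (simp add: mult_nonpos_nonneg)
          with assms(2)[of r] R r show ?thesis by auto
        qed
        ultimately show "r \<in> D"
          using R r upper by (auto simp: D_def)
      qed
    qed
  qed

  have "ereal (1 - q) \<le> upper_linear_density D"
  proof (cases "q < 1")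
    case True
    have "q \<ge> 0" by (simp add: q_def)
    \<comment> \<open>For \<open>a > 0\<close> the value \<open>s = q\<close> gives only equality
      \<open>a = \<tau> * s powr \<rho>\<close>, so \<open>bound\<close> is applied to
      \<open>s > q\<close> and \<open>s\<close> then tends to \<open>q\<close>.\<close>
    have "\<forall>\<^sub>F s in at_right q. s \<in> {q<..<1}"
      using True by (rule eventually_at_right_real)
    then have "\<forall>\<^sub>F s in at_right q. ereal (1 - s) \<le> upper_linear_density D"
    proof eventually_elim
      case (elim s)
      have "a / \<tau> < s powr \<rho>"
      proof (cases "a > 0")
        case True
        then have "a / \<tau> = q powr \<rho>"
          using assms by (simp add: q_def powr_powr)
        also have "\<dots> < s powr \<rho>"
          using elim \<open>q \<ge> 0\<close> \<open>\<rho> > 0\<close> by (intro powr_less_mono2) auto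
        finally show ?thesis .
      next
        case False
        then have "a / \<tau> \<le> 0" using \<open>\<tau> > 0\<close> by (simp add: divide_nonpos_pos)
        also have "0 < s powr \<rho>" using elim \<open>q \<ge> 0\<close> by simp
        finally show ?thesis .
      qed
      then show ?case
        using elim \<open>q \<ge> 0\<close> \<open>\<tau> > 0\<close> by (intro bound) (auto simp: field_simps)
    qed
    moreover have "((\<lambda>s. ereal (1 - s)) \<longlongrightarrow> ereal (1 - q)) (at_right q)"
      by (intro tendsto_intros)
    ultimately show ?thesis
      by (intro tendsto_upperbound) auto
  next
    case False
    \<comment> \<open>Possible for \<open>\<epsilon>\<^sub>0 \<ge> 2 \<tau>\<close>, as \<open>powr\<close> takes the absolute value of a negative base.\<close>
    have "a \<le> 0"
    proof (rule ccontr)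
      assume "\<not> a \<le> 0"
      then have "q < 1 powr (1 / \<rho>)"
        unfolding q_def using assms by (intro powr_less_mono2) (auto simp: a_def)
      with False show False by simp
    qed
    \<comment> \<open>With \<open>a \<le> 0\<close> every \<open>s\<close> in \<open>(0, 1)\<close>
      is admissible in \<open>bound\<close>; since \<open>1 - q \<le> 0\<close>, the choice
      \<open>1 / 2\<close> is arbitrary.\<close>
    then have "ereal (1 - 1 / 2) \<le> upper_linear_density D"
      using \<open>\<tau> > 0\<close> by (intro bound) (auto intro: le_less_trans)
    moreover have "ereal (1 - q) \<le> ereal (1 - 1 / 2)"
      using False by simp
    ultimately show ?thesis by (rule order_trans[rotated])
  qed
  then show ?thesis
    by (simp add: D_def q_def a_def)
qed

end
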